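(* The number of order types of $3\times3$ semimagic squares, i.e. the number of linear orderings of the nine cells that are induced by $3\times 3$ semimagic squares (with arbitrarily large entries), is $1296$. Up to the $72$ symmetries of a semimagic square there are exactly $18$ symmetry classes of order types.
   Context: A $3\times3$ semimagic square (in the strong sense) is a $3\times 3$ matrix of pairwise distinct positive integers in which all three row sums and all three column sums are equal. Its order type is the linear ordering of the nine cells in order of increasing value of their entries. The symmetries form the group of order $72=2(3!)^2$ generated by row permutations, column permutations and reflection in the main diagonal (transposition). *)

theory Defs
  imports "HOL-Analysis.Finite_Cartesian_Product" "HOL-Combinatorics.Permutations"
    "HOL-Algebra.Bij" "HOL-Algebra.Generated_Groups"
begin

type_synonym cell = "3 \<times> 3"

definition semimagic :: "nat ^ 3 ^ 3 \<Rightarrow> bool" where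
  "semimagic A \<longleftrightarrow>
     (\<forall>i j. 0 < A $ i $ j) \<and>
     inj (\<lambda>(i, j). A $ i $ j) \<and>
     (\<exists>s. (\<forall>i. (\<Sum>j\<in>UNIV. A $ i $ j) = s) \<and> (\<forall>j. (\<Sum>i\<in>UNIV. A $ i $ j) = s))"

definition order_type :: "nat ^ 3 ^ 3 \<Rightarrow> cell rel" where
  "order_type A = {((i, j), (k, l)). A $ i $ j \<le> A $ k $ l}"

lemma linear_order_order_type:
  assumes "semimagic A"
  shows "linear_order (order_type A)"
proof -
  have inj: "i = k \<and> j = l" if "A $ i $ j = A $ k $ l" for i j k l
  proof -
    have "inj (\<lambda>(i, j). A $ i $ j)" using assms by (simp add: semimagic_def)
    from injD[OF this, of "(i, j)" "(k, l)"] that show ?thesis by simp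
  qed
  show ?thesis
    unfolding order_on_defs order_type_def refl_on_def trans_def antisym_def total_on_def
    using inj by (auto intro: order_trans dest: order_antisym)
qed

definition order_types :: "cell rel set" where
  "order_types = {order_type A | A. semimagic A}"

text \<open>The symmetries, as permutations of the set of cells: the subgroup of the symmetric group on
  the nine cells that is generated by the row permutations, the column permutations and
  transposition.\<close>

definition symmetries :: "(cell \<Rightarrow> cell) set" where
  "symmetries = generate (BijGroup UNIV)
     ({map_prod p id | p. bij p} \<union> {map_prod id q | q. bij q} \<union> {prod.swap})"

text \<open>The symmetry \<open>g\<close> moves the entry in cell \<open>c\<close> to cell \<open>g c\<close>, so it carries an ordering
  \<open>r\<close> of the cells to its image under \<open>map_prod g g\<close>.\<close>

definition symmetric_order_types :: "cell rel rel" where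
  "symmetric_order_types =
     {(r, r'). r \<in> order_types \<and> r' \<in> order_types \<and> (\<exists>g\<in>symmetries. r' = map_prod g g ` r)}"

lemma mult_BijGroup_UNIV [simp]:
  "bij f \<Longrightarrow> bij g \<Longrightarrow> f \<otimes>\<^bsub>BijGroup UNIV\<^esub> g = f \<circ> g"
  by (auto simp: BijGroup_def Bij_def compose_def fun_eq_iff)

lemma one_BijGroup_UNIV [simp]: "\<one>\<^bsub>BijGroup UNIV\<^esub> = id"
  by (auto simp: BijGroup_def fun_eq_iff)

lemma bij_map_prod_cell:
  "bij p \<Longrightarrow> bij q \<Longrightarrow> bij (map_prod p q)"
  using bij_betw_map_prod[of p UNIV UNIV q UNIV UNIV] by simp

lemma symmetries_eq:
  "symmetries =
     {map_prod p q | p q. bij p \<and> bij q} \<union> {prod.swap \<circ> map_prod p q | p q. bij p \<and> bij q}"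
    (is "_ = ?R")
proof
  let ?G = "BijGroup (UNIV :: cell set)"
  let ?S = "{map_prod p id | p. bij p} \<union> {map_prod id q | q. bij q} \<union> {prod.swap :: cell \<Rightarrow> cell}"
  interpret G: group ?G by (rule group_BijGroup)
  have car: "carrier ?G = {f. bij f}"
    by (auto simp: BijGroup_def Bij_def)
  have bS: "bij f" if "f \<in> ?S" for f
    using that by (auto intro: bij_map_prod_cell)
  have bR: "bij f" if "f \<in> ?R" for f
    using that by (auto intro!: bij_map_prod_cell bij_comp)
  have RI: "map_prod p q \<in> ?R" "prod.swap \<circ> map_prod p q \<in> ?R" if "bij p" "bij q" for p q
    using that by blast+
  have inv_eq: "inv\<^bsub>?G\<^esub> f = g" if "bij f" "bij g" "g \<circ> f = id" for f g
    by (rule G.inv_equality) (use that car in auto)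
  have SE: "(\<exists>p. bij p \<and> f = map_prod p id) \<or> (\<exists>q. bij q \<and> f = map_prod id q) \<or> f = prod.swap"
    if "f \<in> ?S" for f
    using that by (elim UnE CollectE insertE emptyE exE conjE) blast+
  have SR: "f \<in> ?R" if f: "f \<in> ?S" for f
    using SE[OF f]
  proof (elim disjE exE conjE)
    assume "f = prod.swap"
    then show ?thesis using RI(2)[OF bij_id bij_id] by (simp only: map_prod.id comp_id)
  qed (simp_all only: RI bij_id)
  have invR: "inv\<^bsub>?G\<^esub> f \<in> ?R" if f: "f \<in> ?S" for f
    using SE[OF f]
  proof (elim disjE exE conjE)
    fix p assume p: "bij p" and f: "f = map_prod p id"
    have "inv\<^bsub>?G\<^esub> f = map_prod (inv_into UNIV p) id"
      unfolding f by (rule inv_eq) (use p in \<open>auto intro!: bij_map_prod_cell bij_imp_bij_inv simp: map_prod.comp map_prod.id bij_is_inj\<close>)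
    then show ?thesis using RI(1)[OF bij_imp_bij_inv[OF p] bij_id] by (simp only:)
  next
    fix q assume q: "bij q" and f: "f = map_prod id q"
    have "inv\<^bsub>?G\<^esub> f = map_prod id (inv_into UNIV q)"
      unfolding f by (rule inv_eq) (use q in \<open>auto intro!: bij_map_prod_cell bij_imp_bij_inv simp: map_prod.comp map_prod.id bij_is_inj\<close>)
    then show ?thesis using RI(1)[OF bij_id bij_imp_bij_inv[OF q]] by (simp only:)
  next
    assume f: "f = prod.swap"
    have "inv\<^bsub>?G\<^esub> f = prod.swap"
      unfolding f by (rule inv_eq) (auto simp: fun_eq_iff)
    then show ?thesis using RI(2)[OF bij_id bij_id] by (simp only: map_prod.id comp_id)
  qed
  have RE: "\<exists>p q b. bij p \<and> bij q \<and> f = (if b then prod.swap else id) \<circ> map_prod p q"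
    if f: "f \<in> ?R" for f
  proof -
    from f obtain p q where "bij p" "bij q" "f = map_prod p q \<or> f = prod.swap \<circ> map_prod p q"
      by auto
    then show ?thesis
      by (intro exI[of _ p] exI[of _ q] exI[of _ "f \<noteq> map_prod p q"]) auto
  qed
  have mulR: "f \<circ> g \<in> ?R" if f: "f \<in> ?R" and g: "g \<in> ?R" for f g
  proof -
    obtain p q b where 1: "bij p" "bij q" "f = (if b then prod.swap else id) \<circ> map_prod p q"
      using RE[OF f] by blast
    obtain p' q' c where 2: "bij p'" "bij q'" "g = (if c then prod.swap else id) \<circ> map_prod p' q'"
      using RE[OF g] by blast
    have "f \<circ> g = (if b = c then id else prod.swap) \<circ>
        (if c then map_prod (q \<circ> p') (p \<circ> q') else map_prod (p \<circ> p') (q \<circ> q'))"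
      unfolding 1 2 by (auto simp: fun_eq_iff)
    then show ?thesis
      using RI[of "q \<circ> p'" "p \<circ> q'"] RI[of "p \<circ> p'" "q \<circ> q'"] 1(1,2) 2(1,2)
      by (cases "b = c"; cases c) (simp_all add: bij_comp del: Un_iff)
  qed
  show "symmetries \<subseteq> ?R"
  proof
    fix f assume "f \<in> symmetries"
    then show "f \<in> ?R" unfolding symmetries_def
    proof (induction rule: generate.induct)
      case one
      have "map_prod id id \<in> ?R" by (rule RI) auto
      then show ?case by (simp only: one_BijGroup_UNIV map_prod.id)
    next
      case (incl h) then show ?case by (rule SR)
    next
      case (inv h) then show ?case by (rule invR)
    next
      case (eng h1 h2)
      then show ?case using mulR bR by (simp only: mult_BijGroup_UNIV)
    qed
  qed
  have gen: "map_prod p q \<in> symmetries" if "bij p" "bij q" for p q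
  proof -
    have "map_prod p id \<otimes>\<^bsub>?G\<^esub> map_prod id q \<in> symmetries"
      unfolding symmetries_def using that by (intro generate.eng generate.incl) blast+
    then show ?thesis using that
      by (simp add: bij_map_prod_cell map_prod.comp[symmetric] map_prod.comp)
  qed
  have "prod.swap \<circ> map_prod p q \<in> symmetries" if "bij p" "bij q" for p q
  proof -
    have "prod.swap \<otimes>\<^bsub>?G\<^esub> map_prod p q \<in> symmetries"
      unfolding symmetries_def
      by (rule generate.eng[OF generate.incl gen[OF that, unfolded symmetries_def]]) blast
    then show ?thesis using that by (simp add: bij_map_prod_cell)
  qed
  then show "?R \<subseteq> symmetries" using gen by blast
qed

lemma card_symmetries: "card symmetries = 72"
proof -
  let ?P = "{p :: 3 \<Rightarrow> 3. bij p}"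
  let ?A = "(\<lambda>(p, q). map_prod p q :: cell \<Rightarrow> cell) ` (?P \<times> ?P)"
  let ?B = "(\<lambda>(p, q). prod.swap \<circ> map_prod p q :: cell \<Rightarrow> cell) ` (?P \<times> ?P)"
  have P: "?P = {p. p permutes UNIV}"
    by (auto simp: permutes_def bij_iff)
  have cP: "card ?P = 6" unfolding P by (subst card_permutations[of _ 3]) (auto simp: fact_numeral)
  have cA: "card ?A = 36"
    by (subst card_image) (auto simp: inj_on_def fun_eq_iff card_cartesian_product cP)
  have cB: "card ?B = 36"
    by (subst card_image) (auto simp: inj_on_def fun_eq_iff card_cartesian_product cP)
  have "?A \<inter> ?B = {}"
  proof -
    have False if "bij p" and eq: "map_prod p q = prod.swap \<circ> map_prod p' q'"
      for p q p' q' :: "3 \<Rightarrow> 3"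
    proof -
      have "p i = q' j" for i j using fun_cong[OF eq, of "(i, j)"] by simp
      then have "p 0 = p 1" by metis
      then have "(0::3) = 1" using \<open>bij p\<close> by (metis bij_is_inj injD)
      then show False by simp
    qed
    then show ?thesis by auto
  qed
  moreover have "symmetries = ?A \<union> ?B" unfolding symmetries_eq by auto
  moreover have "finite ?A" "finite ?B"
    using cA cB by (auto intro: card_ge_0_finite)
  ultimately show ?thesis using card_Un_disjoint[of ?A ?B] by (simp only: cA cB)
qed

lemma equiv_symmetric_order_types: "equiv order_types symmetric_order_types"
proof (rule equivI)
  have [simp]: "bij g" if "g \<in> symmetries" for g
    using that unfolding symmetries_eq by (auto intro!: bij_map_prod_cell bij_comp)
  interpret G: group "BijGroup (UNIV :: cell set)" by (rule group_BijGroup)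
  have sub: "subgroup symmetries (BijGroup UNIV)"
    unfolding symmetries_def
    by (rule G.generate_is_subgroup) (auto simp: BijGroup_def Bij_def intro: bij_map_prod_cell)
  show "symmetric_order_types \<subseteq> order_types \<times> order_types"
    by (auto simp: symmetric_order_types_def)
  show "refl_on order_types symmetric_order_types"
    using subgroup.one_closed[OF sub]
    by (auto simp: refl_on_def symmetric_order_types_def map_prod.id intro!: bexI[of _ id])
  have im: "map_prod g g ` map_prod h h ` r = map_prod (g \<circ> h) (g \<circ> h) ` r" for g h :: "cell \<Rightarrow> cell" and r
    by (simp add: image_image map_prod.comp[symmetric])
  have comp: "g \<circ> h \<in> symmetries" if "g \<in> symmetries" "h \<in> symmetries" for g h
    using subgroup.m_closed[OF sub that] that by simp
  have inv: "\<exists>h\<in>symmetries. h \<circ> g = id" if g: "g \<in> symmetries" for g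
  proof -
    let ?h = "inv\<^bsub>BijGroup UNIV\<^esub> g"
    have h: "?h \<in> symmetries" using subgroup.m_inv_closed[OF sub g] .
    have "?h \<otimes>\<^bsub>BijGroup UNIV\<^esub> g = \<one>\<^bsub>BijGroup UNIV\<^esub>"
      using subgroup.mem_carrier[OF sub g] by (rule G.l_inv)
    then have "?h \<circ> g = id" using g h by simp
    with h show ?thesis by blast
  qed
  show "sym symmetric_order_types"
  proof (rule symI)
    fix r r' assume "(r, r') \<in> symmetric_order_types"
    then obtain g where r: "r \<in> order_types" "r' \<in> order_types"
      and g: "g \<in> symmetries" "r' = map_prod g g ` r"
      by (auto simp: symmetric_order_types_def)
    from inv[OF g(1)] obtain h where h: "h \<in> symmetries" "h \<circ> g = id" by blast
    have "map_prod h h ` r' = r" by (simp add: g(2) im h(2) map_prod.id)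
    with r h(1) show "(r', r) \<in> symmetric_order_types"
      unfolding symmetric_order_types_def by blast
  qed
  show "trans symmetric_order_types"
  proof (rule transI)
    fix r r' r'' assume "(r, r') \<in> symmetric_order_types" "(r', r'') \<in> symmetric_order_types"
    then obtain g h where r: "r \<in> order_types" "r'' \<in> order_types"
      and g: "g \<in> symmetries" "h \<in> symmetries" "r'' = map_prod h h ` map_prod g g ` r"
      by (auto simp: symmetric_order_types_def)
    from g(3) have "r'' = map_prod (h \<circ> g) (h \<circ> g) ` r" by (simp only: im)
    with r comp[OF g(2,1)] show "(r, r'') \<in> symmetric_order_types"
      unfolding symmetric_order_types_def by blast
  qed
qed

end

(*
  A symmetry that preserves a linear ordering of the cells is the identity, so every orbit of order
  types has exactly 72 elements and it suffices to count orbits. Each orbit contains exactly one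
  ordering in normal form: the least entry z is in the top left corner, its row is z < x < y, its
  column is z < u < v, and x < u. With z normalised to 0, the square is

     0    x    y         x = q + t,    y = u + v - q - t,
     u    p    q         p = v - q,
     v    r    t         r = u - t.

  This forces q, t < x < u < v < y, q < r < u and t < p < v. The comparisons left open are those
  of q with t, of r with t and x, and of p with q, x, u and r; exactly 18 combinations of their
  outcomes are consistent.
*)

theory Submission
  imports Defs "HOL-Analysis.Cartesian_Space"
begin

section \<open>Finite linear orders encoded as lists\<close>

fun list_order :: "'a list \<Rightarrow> 'a rel" where
  "list_order [] = {}"
| "list_order (x # xs) = {x} \<times> insert x (set xs) \<union> list_order xs"

lemma list_order_subset: "list_order xs \<subseteq> set xs \<times> set xs"
  by (induction xs) auto

lemma list_order_eq_of_sorted: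
  fixes f :: "'a \<Rightarrow> 'b :: linorder"
  assumes "sorted_wrt (\<lambda>a b. f a < f b) xs"
  shows "list_order xs = {(a, b). a \<in> set xs \<and> b \<in> set xs \<and> f a \<le> f b}"
  using assms by (induction xs) (auto simp: less_le_not_le)

text \<open>The head of a distinct list is the least element of its order, hence determined by it;
  deleting the pairs that start with the head leaves the order of the tail, so induction
  applies.\<close>

lemma list_order_inject:
  assumes "distinct xs" "distinct ys" "set xs = set ys" "list_order xs = list_order ys"
  shows "xs = ys"
  using assms
proof (induction xs arbitrary: ys)
  case Nil
  then show ?case by simp
next
  case (Cons x xs)
  then obtain y zs where ys: "ys = y # zs" by (cases ys) auto
  have xy: "x = y"
  proof (rule ccontr)
    assume "x \<noteq> y"
    \<comment> \<open>As \<open>x\<close> differs from \<open>y\<close>, the first pair must come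
      from \<open>list_order zs\<close> or put \<open>y\<close> first twice; together the two pairs
      place \<open>y\<close> in its own tail.\<close>
    moreover have "(x, y) \<in> list_order (y # zs)" "(y, x) \<in> list_order (x # xs)"
      using Cons.prems(3,4) ys by auto
    ultimately have "y \<in> set zs" using list_order_subset[of zs] by auto
    then show False using Cons.prems(2) ys by simp
  qed
  have minus: "list_order zs = list_order (z # zs) - {z} \<times> UNIV" if "z \<notin> set zs" for z :: 'a and zs
    using list_order_subset[of zs] that by auto
  have notin: "x \<notin> set xs" "x \<notin> set zs" using Cons.prems(1,2) ys xy by auto
  have "list_order xs = list_order zs"
    using minus[OF notin(1)] minus[OF notin(2)] Cons.prems(4)[unfolded ys xy[symmetric]] by metis
  moreover have "set xs = set zs"
    using insert_ident[OF notin] Cons.prems(3) ys xy by simp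
  ultimately show ?case using Cons.IH[of zs] Cons.prems(1,2) ys xy by simp
qed

lemma list_order_map: "list_order (map g xs) = map_prod g g ` list_order xs"
  by (induction xs) (auto simp: image_Un)

lemma sorted_wrt_less_imp_distinct:
  fixes f :: "'a \<Rightarrow> 'b :: linorder"
  shows "sorted_wrt (\<lambda>a b. f a < f b) xs \<Longrightarrow> distinct xs"
  by (induction xs) auto

lemma ex_sorted_enumeration:
  fixes f :: "'a :: finite \<Rightarrow> 'b :: linorder"
  assumes "inj f"
  shows "\<exists>xs. set xs = UNIV \<and> sorted_wrt (\<lambda>a b. f a < f b) xs"
proof (intro exI conjI)
  let ?xs = "map (inv_into UNIV f) (sorted_list_of_set (range f))"
  show "set ?xs = UNIV" using assms by (auto simp: image_comp)
  have "sorted_wrt (\<lambda>a b. f (inv_into UNIV f a) < f (inv_into UNIV f b)) (sorted_list_of_set (range f))"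
    by (rule sorted_wrt_mono_rel[OF _ strict_sorted_list_of_set]) (auto simp: f_inv_into_f)
  then show "sorted_wrt (\<lambda>a b. f a < f b) ?xs"
    by (simp add: sorted_wrt_map)
qed

lemma order_type_eq_list_order:
  assumes "set xs = UNIV" "sorted_wrt (\<lambda>(i, j) (k, l). A $ i $ j < A $ k $ l) xs"
  shows "order_type A = list_order xs"
proof -
  let ?f = "\<lambda>(i, j). A $ i $ j"
  have "sorted_wrt (\<lambda>a b. ?f a < ?f b) xs"
    using assms(2) by (simp add: case_prod_unfold)
  from list_order_eq_of_sorted[OF this] assms(1) show ?thesis
    by (auto simp: order_type_def)
qed

lemma order_type_list:
  assumes "r \<in> order_types"
  obtains xs where "set xs = UNIV" "distinct xs" "r = list_order xs"
proof -
  from assms obtain A where A: "semimagic A" "r = order_type A"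
    by (auto simp: order_types_def)
  let ?f = "\<lambda>(i, j). A $ i $ j"
  obtain xs where xs: "set xs = UNIV" "sorted_wrt (\<lambda>a b. ?f a < ?f b) xs"
    using ex_sorted_enumeration[of ?f] A(1) by (auto simp: semimagic_def)
  then have "order_type A = list_order xs"
    by (intro order_type_eq_list_order) (simp_all add: case_prod_unfold)
  with that xs A(2) sorted_wrt_less_imp_distinct[OF xs(2)] show thesis by blast
qed

subsection \<open>The action of the symmetries\<close>

lemma bij_symmetries: "g \<in> symmetries \<Longrightarrow> bij g"
  unfolding symmetries_eq by (auto intro!: bij_map_prod_cell bij_comp)

lemma order_type_image:
  assumes "bij g" "\<And>i j. (case g (i, j) of (k, l) \<Rightarrow> B $ k $ l) = A $ i $ j"
  shows "order_type B = map_prod g g ` order_type A"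
proof -
  have iff: "(g c, g d) \<in> order_type B \<longleftrightarrow> (c, d) \<in> order_type A" for c d
    using assms(2)[of "fst c" "snd c"] assms(2)[of "fst d" "snd d"]
    by (simp add: order_type_def case_prod_unfold)
  show ?thesis
  proof (intro equalityI subsetI)
    fix e assume e: "e \<in> order_type B"
    obtain c d where "e = (g c, g d)" using assms(1) by (metis bij_pointE surj_pair)
    with e iff show "e \<in> map_prod g g ` order_type A" by (auto intro!: rev_image_eqI[of "(c, d)"])
  qed (use iff in auto)
qed

lemma semimagic_permute:
  assumes "semimagic A" "bij p" "bij q"
  shows "semimagic (\<chi> i j. A $ p i $ q j)"
proof -
  have "inj ((\<lambda>(i, j). A $ i $ j) \<circ> map_prod p q)"
    using assms bij_map_prod_cell[of p q] by (intro inj_compose) (auto simp: semimagic_def bij_is_inj)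
  moreover have "(\<Sum>j\<in>UNIV. A $ p i $ q j) = (\<Sum>j\<in>UNIV. A $ p i $ j)" for i
    using sum.reindex_bij_betw[OF assms(3)] .
  moreover have "(\<Sum>i\<in>UNIV. A $ p i $ q j) = (\<Sum>i\<in>UNIV. A $ i $ q j)" for j
    using sum.reindex_bij_betw[OF assms(2)] .
  ultimately show ?thesis
    using assms(1) by (auto simp: semimagic_def comp_def case_prod_unfold map_prod_def)
qed

text \<open>The entry in cell \<open>(i, j)\<close> of the permuted square stems from cell
  \<open>(p i, q j)\<close> of \<open>A\<close>. Thus \<open>map_prod p q\<close> leads from the
  permuted square back to \<open>A\<close>, not the other way.\<close>

lemma order_type_permute:
  assumes "bij p" "bij q"
  shows "order_type A = map_prod (map_prod p q) (map_prod p q) ` order_type (\<chi> i j. A $ p i $ q j)"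
  using assms by (intro order_type_image bij_map_prod_cell) auto

lemma semimagic_transpose:
  assumes "semimagic A"
  shows "semimagic (\<chi> i j. A $ j $ i)"
proof -
  have "inj ((\<lambda>(i, j). A $ i $ j) \<circ> prod.swap)"
    using assms by (intro inj_compose) (auto simp: semimagic_def)
  then show ?thesis
    using assms by (auto simp: semimagic_def comp_def case_prod_unfold)
qed

lemma order_type_transpose:
  "order_type (\<chi> i j. A $ j $ i) = map_prod prod.swap prod.swap ` order_type A"
  by (intro order_type_image) auto

lemma symmetries_image_order_types:
  assumes "g \<in> symmetries" "r \<in> order_types"
  shows "map_prod g g ` r \<in> order_types"
proof -
  have map_prod: "map_prod (map_prod p q) (map_prod p q) ` s \<in> order_types"
    if pq: "bij p" "bij q" and "s \<in> order_types" for p q s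
  proof -
    from that obtain A where A: "semimagic A" "s = order_type A" by (auto simp: order_types_def)
    \<comment> \<open>The inverses appear because the entry of \<open>A\<close> in cell
      \<open>c\<close> has to end up in cell \<open>map_prod p q c\<close>.\<close>
    let ?B = "\<chi> i j. A $ inv_into UNIV p i $ inv_into UNIV q j"
    have "order_type ?B = map_prod (map_prod p q) (map_prod p q) ` order_type A"
      using pq by (intro order_type_image bij_map_prod_cell) (auto simp: bij_is_inj)
    with A semimagic_permute[OF A(1) bij_imp_bij_inv[OF pq(1)] bij_imp_bij_inv[OF pq(2)]]
    show ?thesis unfolding order_types_def by blast
  qed
  have swap: "map_prod prod.swap prod.swap ` s \<in> order_types" if "s \<in> order_types" for s
  proof -
    from that obtain A where A: "semimagic A" "s = order_type A" by (auto simp: order_types_def)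
    with semimagic_transpose[OF A(1)] order_type_transpose[of A] show ?thesis
      unfolding order_types_def by blast
  qed
  have comp: "map_prod (prod.swap \<circ> h) (prod.swap \<circ> h) ` r =
      map_prod prod.swap prod.swap ` map_prod h h ` r" for h :: "cell \<Rightarrow> cell"
    by (simp add: image_image map_prod.comp[symmetric])
  from assms(1)[unfolded symmetries_eq] show ?thesis
    using map_prod[OF _ _ assms(2)] swap by (auto simp: comp)
qed

section \<open>Size and number of the orbits\<close>

lemma orbit_eq:
  "r \<in> order_types \<Longrightarrow> symmetric_order_types `` {r} = (\<lambda>g. map_prod g g ` r) ` symmetries"
  using symmetries_image_order_types by (auto simp: symmetric_order_types_def)

text \<open>The action is free: if \<open>g\<close> and \<open>h\<close> give \<open>r\<close> the
  same image, they send the increasing enumeration \<open>xs\<close> of all cells to two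
  enumerations of the same order, which coincide by \<open>list_order_inject\<close>. Hence
  \<open>g = h\<close>.\<close>

lemma card_orbit:
  assumes "r \<in> order_types"
  shows "card (symmetric_order_types `` {r}) = 72"
proof -
  obtain xs where xs: "set xs = UNIV" "distinct xs" "r = list_order xs"
    using order_type_list[OF assms] .
  have "inj_on (\<lambda>g. map_prod g g ` r) symmetries"
  proof (rule inj_onI)
    fix g h assume gh: "g \<in> symmetries" "h \<in> symmetries" "map_prod g g ` r = map_prod h h ` r"
    then have "map g xs = map h xs"
      using xs bij_symmetries
      by (intro list_order_inject)
        (auto simp: distinct_map list_order_map bij_is_inj bij_is_surj intro: inj_on_subset)
    then show "g = h" using xs(1) by (auto simp: fun_eq_iff)
  qed
  then show ?thesis
    by (simp add: orbit_eq[OF assms] card_image card_symmetries)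
qed

lemma card_order_types: "card order_types = 72 * card (order_types // symmetric_order_types)"
proof -
  note eq = equiv_symmetric_order_types
  have "72 * card (order_types // symmetric_order_types) =
      card (\<Union> (order_types // symmetric_order_types))"
  proof (intro card_partition)
    show "card X = 72" if "X \<in> order_types // symmetric_order_types" for X
      using that card_orbit by (auto elim: quotientE)
    show "X \<inter> Y = {}" if "X \<in> order_types // symmetric_order_types"
      "Y \<in> order_types // symmetric_order_types" "X \<noteq> Y" for X Y
      using quotient_disj[OF eq that(1,2)] that(3) by blast
  qed simp_all
  then show ?thesis by (simp add: Union_quotient[OF eq])
qed

subsection \<open>Normal forms\<close>

text \<open>The indices 1, 2, 3 exhaust the type \<open>3\<close>, in which 3 denotes the same
  element as 0.\<close>

definition normal :: "cell rel \<Rightarrow> bool" where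
  "normal r \<longleftrightarrow> (\<forall>c. ((1, 1), c) \<in> r) \<and>
     ((1, 2), (1, 3)) \<in> r \<and> ((2, 1), (3, 1)) \<in> r \<and> ((1, 2), (2, 1)) \<in> r"

text \<open>The transposition of 1 and \<open>i\<close> brings \<open>i\<close> to the front;
  composing it with the exchange of 2 and 3 swaps the other two values, and one of the two versions
  is sorted.\<close>

lemma ex_bij_sorting:
  fixes f :: "3 \<Rightarrow> nat"
  shows "\<exists>p. bij p \<and> p (1 :: 3) = i \<and> f (p 2) \<le> f (p 3)"
proof -
  let ?p = "transpose 1 i"
  let ?q = "?p \<circ> transpose 2 3"
  have "bij ?p" "bij ?q" by (auto intro: bij_comp)
  moreover have "?p 1 = i" "?q 1 = i" "?q 2 = ?p 3" "?q 3 = ?p 2"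
    by (simp_all add: transpose_apply_other)
  ultimately show ?thesis by (metis linear)
qed

text \<open>Permuting rows and columns brings the least entry to the corner and sorts the rest of
  its row and column; a transposition then settles the comparison of \<open>x\<close> with
  \<open>u\<close>.\<close>

lemma ex_normal:
  assumes "r \<in> order_types"
  shows "\<exists>s. (r, s) \<in> symmetric_order_types \<and> normal s"
proof -
  note eq = equiv_symmetric_order_types
  from assms obtain A where A: "semimagic A" "r = order_type A" by (auto simp: order_types_def)
  let ?f = "\<lambda>(i, j). A $ i $ j"
  have "\<exists>c. \<forall>d. ?f c \<le> ?f d"
    using finite_UNIV ex_min_if_finite[of "range ?f"] by (auto simp: not_less)
  then obtain k l where kl: "\<And>i j. A $ k $ l \<le> A $ i $ j" by auto
  obtain p :: "3 \<Rightarrow> 3" where p: "bij p" "p 1 = k" "A $ p 2 $ l \<le> A $ p 3 $ l"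
    using ex_bij_sorting[of k "\<lambda>i. A $ i $ l"] by auto
  obtain q :: "3 \<Rightarrow> 3" where q: "bij q" "q 1 = l" "A $ k $ q 2 \<le> A $ k $ q 3"
    using ex_bij_sorting[of l "\<lambda>j. A $ k $ j"] by auto
  let ?B = "\<chi> i j. A $ p i $ q j"
  let ?C = "\<chi> i j. ?B $ j $ i"
  have B: "semimagic ?B" using semimagic_permute[OF A(1) p(1) q(1)] .
  have C: "semimagic ?C" using semimagic_transpose[OF B] .
  have "map_prod p q \<in> symmetries" using p(1) q(1) unfolding symmetries_eq by blast
  then have "(order_type ?B, r) \<in> symmetric_order_types"
    using A B order_type_permute[OF p(1) q(1), of A]
    unfolding symmetric_order_types_def order_types_def by blast
  then have rB: "(r, order_type ?B) \<in> symmetric_order_types"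
    using eq by (meson equivE symE)
  have "prod.swap \<in> symmetries" unfolding symmetries_def by (rule generate.incl) blast
  then have "(order_type ?B, order_type ?C) \<in> symmetric_order_types"
    using B C order_type_transpose[of ?B]
    unfolding symmetric_order_types_def order_types_def by blast
  with rB have rC: "(r, order_type ?C) \<in> symmetric_order_types"
    using eq by (meson equivE transE)
  \<comment> \<open>Transposition exchanges the sorting conditions on the first row and the first
    column, so both survive in \<open>?C\<close>.\<close>
  show ?thesis
  proof (cases "?B $ 1 $ 2 \<le> ?B $ 2 $ 1")
    case True
    then have "normal (order_type ?B)" using kl p q by (auto simp: normal_def order_type_def)
    with rB show ?thesis by blast
  next
    case False
    then have "normal (order_type ?C)" using kl p q by (auto simp: normal_def order_type_def)
    with rC show ?thesis by blast
  qed
qed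

text \<open>The connecting symmetry fixes the corner, which is least in both orders. Without
  transposition, sortedness of the first row and column forces it to be the identity; with
  transposition, \<open>(1, 2)\<close> would get two incompatible positions.\<close>

lemma normal_unique:
  assumes rs: "(r, s) \<in> symmetric_order_types" and r: "normal r" and s: "normal s"
  shows "r = s"
proof -
  obtain g where g: "g \<in> symmetries" "s = map_prod g g ` r" and "s \<in> order_types"
    using rs by (auto simp: symmetric_order_types_def)
  then have "linear_order s" by (auto simp: order_types_def intro: linear_order_order_type)
  then have anti: "c = d" if "(c, d) \<in> s" "(d, c) \<in> s" for c d
    using antisymD[OF _ that] by (auto simp: order_on_defs)
  have trans: "(c, e) \<in> s" if "(c, d) \<in> s" "(d, e) \<in> s" for c d e
    using \<open>linear_order s\<close> that by (auto simp: order_on_defs dest: transD)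
  have img: "(g c, g d) \<in> s" if "(c, d) \<in> r" for c d
    using g(2) that by force
  have r11: "((1, 1), c) \<in> r" and s11: "((1, 1), c) \<in> s" for c
    using r s unfolding normal_def by blast+
  have corner: "g (1, 1) = (1, 1)"
  proof (rule anti)
    obtain c where "(1, 1) = g c" using bij_symmetries[OF g(1)] by (metis bij_pointE)
    then show "(g (1, 1), (1, 1)) \<in> s" using img[OF r11, of c] by simp
  qed (rule s11)
  \<comment> \<open>A permutation fixing 1 is the identity or the exchange of 2 and 3; the last
    premise excludes the exchange.\<close>
  have fix1: "p = id" if "bij p" "p 1 = 1" "p 2 \<noteq> 3 \<or> p 3 \<noteq> 2" for p :: "3 \<Rightarrow> 3"
  proof -
    have "p 2 \<noteq> 1" "p 3 \<noteq> 1" "p 2 \<noteq> p 3"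
      using inj_eq[OF bij_is_inj[OF that(1)], of 2 1] inj_eq[OF bij_is_inj[OF that(1)], of 3 1]
        inj_eq[OF bij_is_inj[OF that(1)], of 2 3] that(2) by simp_all
    then have "p 2 = 2 \<and> p 3 = 3" using that(3) exhaust_3[of "p 2"] exhaust_3[of "p 3"] by auto
    with that(2) have "\<forall>i. p i = i" by (simp add: forall_3)
    then show ?thesis by auto
  qed
  from g(1)[unfolded symmetries_eq] show ?thesis
  proof (elim UnE CollectE exE conjE)
    fix p q assume pq: "bij p" "bij q" "g = map_prod p q"
    have "p = id"
    proof (rule fix1)
      show "p 2 \<noteq> 3 \<or> p 3 \<noteq> 2"
        using img[of "(2, 1)" "(3, 1)"] anti[of "(3, 1)" "(2, 1)"] r s corner pq(3)
        by (auto simp: normal_def)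
    qed (use pq corner in auto)
    moreover have "q = id"
    proof (rule fix1)
      show "q 2 \<noteq> 3 \<or> q 3 \<noteq> 2"
        using img[of "(1, 2)" "(1, 3)"] anti[of "(1, 3)" "(1, 2)"] r s corner pq(3)
        by (auto simp: normal_def)
    qed (use pq corner in auto)
    ultimately show "r = s" using g(2) pq(3) by (simp add: map_prod.id)
  next
    fix p q assume pq: "bij p" "bij q" "g = prod.swap \<circ> map_prod p q"
    have p1: "p 1 = 1" "q 1 = 1" using corner pq(3) by auto
    \<comment> \<open>Here \<open>g (1, 2) = (q 2, 1)\<close> and \<open>g (i, 1) = (1, 2)\<close>.
      Since \<open>(1, 2)\<close> lies below the rest of the first column in \<open>r\<close> and in
      \<open>s\<close>, the cells \<open>(q 2, 1)\<close> and \<open>(1, 2)\<close> lie below each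
      other in \<open>s\<close>, contradicting antisymmetry.\<close>
    obtain i where i: "p i = 2" using pq(1) by (metis bij_pointE)
    have "i \<noteq> 1" using i p1 by auto
    have r2: "((1, 2), (2, 1)) \<in> r" "((2, 1), (3, 1)) \<in> r" using r by (auto simp: normal_def)
    have "(g (1, 2), g (2, 1)) \<in> s" "(g (1, 2), g (3, 1)) \<in> s"
      using img[OF r2(1)] trans[OF img[OF r2(1)] img[OF r2(2)]] .
    then have q2: "((q 2, 1), (1, 2)) \<in> s"
      using exhaust_3[of i] \<open>i \<noteq> 1\<close> i p1 pq(3) by auto
    have "q 2 \<noteq> 1"
      using inj_eq[OF bij_is_inj[OF pq(2)], of 2 1] p1(2) by simp
    moreover have "((1, 2), (2, 1)) \<in> s" "((2, 1), (3, 1)) \<in> s"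
      using s by (simp_all add: normal_def)
    ultimately have "((1, 2), (q 2, 1)) \<in> s"
      using exhaust_3[of "q 2"] trans by metis
    with q2 show "r = s" using anti by fastforce
  qed
qed

lemma bij_betw_normal_orbits:
  "bij_betw (\<lambda>r. symmetric_order_types `` {r}) {r \<in> order_types. normal r}
     (order_types // symmetric_order_types)"
proof (rule bij_betw_imageI)
  note eq = equiv_symmetric_order_types
  show "inj_on (\<lambda>r. symmetric_order_types `` {r}) {r \<in> order_types. normal r}"
    using normal_unique eq_equiv_class[OF _ eq] by (auto intro!: inj_onI)
  show "(\<lambda>r. symmetric_order_types `` {r}) ` {r \<in> order_types. normal r} =
      order_types // symmetric_order_types"
  proof (intro equalityI subsetI)
    fix X assume "X \<in> order_types // symmetric_order_types"
    then obtain r where r: "r \<in> order_types" "X = symmetric_order_types `` {r}"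
      by (auto elim: quotientE)
    obtain s where s: "(r, s) \<in> symmetric_order_types" "normal s" using ex_normal[OF r(1)] by blast
    then have "s \<in> order_types" "X = symmetric_order_types `` {s}"
      using r equiv_class_eq[OF eq s(1)] by (auto simp: symmetric_order_types_def)
    with s(2) show "X \<in> (\<lambda>r. symmetric_order_types `` {r}) ` {r \<in> order_types. normal r}" by blast
  qed (auto intro: quotientI)
qed

subsection \<open>The eighteen normal order types\<close>

text \<open>The parametrised square with 1 added to each entry for positivity. The truncated
  subtractions are exact whenever \<open>q + t < u\<close> and \<open>u < v\<close>.\<close>

definition normal_square :: "nat \<Rightarrow> nat \<Rightarrow> nat \<Rightarrow> nat \<Rightarrow> nat ^ 3 ^ 3" where
  "normal_square q t u v = vector
     [vector [1, 1 + (q + t), 1 + (u + v - (q + t))],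
      vector [1 + u, 1 + (v - q), 1 + q],
      vector [1 + v, 1 + (u - t), 1 + t]]"

text \<open>An entry \<open>(q, t, u, v, ms)\<close> lists the cells other than \<open>z\<close>, \<open>v\<close>, \<open>y\<close> in increasing order
  of their values, where \<open>v\<close> and \<open>y\<close> are always the two greatest values; the numbers are the parameters
  of a \<^const>\<open>normal_square\<close> that realises this order.\<close>

definition normal_table :: "(nat \<times> nat \<times> nat \<times> nat \<times> cell list) list" where
  "normal_table = (let x = (1, 2); u = (2, 1); p = (2, 2); q = (2, 3); r = (3, 2); t = (3, 3) in [
    (3, 5, 9, 10, [q, r, t, p, x, u]),
    (2, 5, 9, 10, [q, r, t, x, p, u]),
    (1, 3, 5, 7, [q, r, t, x, u, p]),
    (4, 5, 11, 12, [q, t, r, p, x, u]),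
    (2, 3, 7, 8, [q, t, r, x, p, u]),
    (2, 3, 7, 10, [q, t, r, x, u, p]),
    (2, 3, 9, 10, [q, t, x, r, p, u]),
    (1, 2, 6, 8, [q, t, x, r, u, p]),
    (5, 2, 8, 9, [t, p, q, r, x, u]),
    (5, 1, 8, 9, [t, p, q, x, r, u]),
    (5, 3, 10, 11, [t, q, p, r, x, u]),
    (5, 2, 10, 11, [t, q, p, x, r, u]),
    (4, 3, 8, 10, [t, q, r, p, x, u]),
    (4, 3, 9, 12, [t, q, r, x, p, u]),
    (3, 2, 6, 10, [t, q, r, x, u, p]),
    (3, 1, 7, 8, [t, q, x, p, r, u]),
    (3, 2, 8, 10, [t, q, x, r, p, u]),
    (2, 1, 5, 8, [t, q, x, r, u, p])])"

definition normal_list :: "cell list \<Rightarrow> cell list" where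
  "normal_list ms = (1, 1) # ms @ [(3, 1), (1, 3)]"

definition normal_lists :: "cell list list" where
  "normal_lists = map (\<lambda>(q, t, u, v, ms). normal_list ms) normal_table"

lemma normal_lists_distinct: "\<forall>xs \<in> set normal_lists. distinct xs \<and> length xs = 9"
  by (simp add: normal_lists_def normal_table_def normal_list_def Let_def)

lemma normal_lists_UNIV:
  assumes "xs \<in> set normal_lists"
  shows "set xs = UNIV"
proof -
  have "card (set xs) = card (UNIV :: cell set)"
    using normal_lists_distinct assms by (simp add: distinct_card)
  then show ?thesis by (intro card_subset_eq) auto
qed

lemma distinct_normal_lists: "distinct normal_lists" "length normal_lists = 18"
  by (simp_all add: normal_lists_def normal_table_def normal_list_def Let_def)

lemma normal_list_order: "xs \<in> set normal_lists \<Longrightarrow> normal (list_order xs)"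
proof -
  assume xs: "xs \<in> set normal_lists"
  have "\<forall>xs \<in> set normal_lists. hd xs = (1, 1) \<and>
      ((1, 2), (1, 3)) \<in> list_order xs \<and> ((2, 1), (3, 1)) \<in> list_order xs \<and>
      ((1, 2), (2, 1)) \<in> list_order xs"
    by (simp add: normal_lists_def normal_table_def normal_list_def Let_def)
  moreover have "(hd xs, c) \<in> list_order xs" for c
    using normal_lists_UNIV[OF xs] by (cases xs) auto
  ultimately show ?thesis using xs by (fastforce simp: normal_def)
qed

section \<open>Realisation of the listed orders by squares, and completeness of the list\<close>

lemma normal_square_simps [simp]:
  "normal_square q t u v $ 1 $ 1 = 1"
  "normal_square q t u v $ 1 $ 2 = 1 + (q + t)"
  "normal_square q t u v $ 1 $ 3 = 1 + (u + v - (q + t))"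
  "normal_square q t u v $ 2 $ 1 = 1 + u"
  "normal_square q t u v $ 2 $ 2 = 1 + (v - q)"
  "normal_square q t u v $ 2 $ 3 = 1 + q"
  "normal_square q t u v $ 3 $ 1 = 1 + v"
  "normal_square q t u v $ 3 $ 2 = 1 + (u - t)"
  "normal_square q t u v $ 3 $ 3 = 1 + t"
  by (simp_all add: normal_square_def vector_3)

lemma normal_square_sorted:
  "\<forall>(q, t, u, v, ms) \<in> set normal_table. q + t < u \<and> u < v \<and>
     sorted_wrt (\<lambda>(i, j) (k, l). normal_square q t u v $ i $ j < normal_square q t u v $ k $ l)
       (normal_list ms)"
  by (simp add: normal_table_def normal_list_def Let_def)

lemma normal_list_semimagic:
  assumes xs: "xs \<in> set normal_lists"
  shows "list_order xs \<in> order_types"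
proof -
  obtain q t u v ms where "(q, t, u, v, ms) \<in> set normal_table" "xs = normal_list ms"
    using xs by (auto simp: normal_lists_def)
  then have less: "q + t < u" "u < v"
    and sorted: "sorted_wrt (\<lambda>(i, j) (k, l). normal_square q t u v $ i $ j < normal_square q t u v $ k $ l) xs"
    using normal_square_sorted by auto
  let ?A = "normal_square q t u v"
  \<comment> \<open>Strict sortedness along a list of all cells makes the nine entries
    distinct.\<close>
  have "distinct (map (\<lambda>(i, j). ?A $ i $ j) xs)"
    using sorted by (intro sorted_wrt_less_imp_distinct[where f = "\<lambda>n. n"])
      (simp add: sorted_wrt_map case_prod_unfold)
  then have "inj (\<lambda>(i, j). ?A $ i $ j)"
    using normal_lists_UNIV[OF xs] by (simp add: distinct_map)
  moreover have "\<forall>i j. 0 < ?A $ i $ j" by (simp add: forall_3)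
  moreover have "(\<forall>i. (\<Sum>j\<in>UNIV. ?A $ i $ j) = 3 + u + v) \<and> (\<forall>j. (\<Sum>i\<in>UNIV. ?A $ i $ j) = 3 + u + v)"
    using less by (simp add: forall_3 sum_3)
  ultimately have "semimagic ?A" unfolding semimagic_def by blast
  moreover have "order_type ?A = list_order xs"
    using order_type_eq_list_order normal_lists_UNIV[OF xs] sorted .
  ultimately show ?thesis by (auto simp: order_types_def)
qed

text \<open>Completeness of the table: the line sums decide all but seven comparisons, and every
  consistent outcome of these seven is listed.\<close>

lemma normal_semimagic_sorted:
  assumes A: "semimagic A" and normal: "normal (order_type A)"
  shows "\<exists>xs\<in>set normal_lists. sorted_wrt (\<lambda>(i, j) (k, l). A $ i $ j < A $ k $ l) xs"
proof -
  have inj: "A $ i $ j = A $ k $ l \<longleftrightarrow> i = k \<and> j = l" for i j k l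
    using A injD[of "\<lambda>(i, j). A $ i $ j" "(i, j)" "(k, l)"] by (auto simp: semimagic_def)
  have le: "A $ 1 $ 1 \<le> A $ i $ j" "A $ 1 $ 2 \<le> A $ 1 $ 3" "A $ 2 $ 1 \<le> A $ 3 $ 1" "A $ 1 $ 2 \<le> A $ 2 $ 1" for i j
    using normal by (auto simp: normal_def order_type_def)
  have min: "A $ 1 $ 1 < A $ i $ j" if "(i, j) \<noteq> (1, 1)" for i j
    using le(1)[of i j] inj[of 1 1 i j] that by auto
  have less: "A $ 1 $ 2 < A $ 1 $ 3" "A $ 2 $ 1 < A $ 3 $ 1" "A $ 1 $ 2 < A $ 2 $ 1"
    using le(2-4) inj by (auto simp: less_le)
  obtain s where "\<And>i. A $ i $ 1 + A $ i $ 2 + A $ i $ 3 = s" "\<And>j. A $ 1 $ j + A $ 2 $ j + A $ 3 $ j = s"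
    using A by (auto simp: semimagic_def sum_3)
  note sums = this(1)[of 1] this(1)[of 2] this(1)[of 3] this(2)[of 1] this(2)[of 2] this(2)[of 3]
  define z x y u v p q r t where "z = A $ 1 $ 1" and "x = A $ 1 $ 2" and "y = A $ 1 $ 3"
    and "u = A $ 2 $ 1" and "v = A $ 3 $ 1" and "p = A $ 2 $ 2" and "q = A $ 2 $ 3"
    and "r = A $ 3 $ 2" and "t = A $ 3 $ 3"
  note defs = this
  note sums = sums[folded defs] and less = less[folded defs]
  have z: "z < x" "z < y" "z < u" "z < v" "z < p" "z < q" "z < r" "z < t"
    using min by (auto simp: defs)
  have neq: "q < t \<or> t < q" "r < t \<or> t < r" "r < x \<or> x < r" "p < q \<or> q < p"
    "p < x \<or> x < p" "p < u \<or> u < p" "p < r \<or> r < p"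
    using inj by (auto simp: defs neq_iff[symmetric])
  \<comment> \<open>Equating a row sum with a column sum cancels the shared cell:
    \<open>q + t = z + x\<close>, \<open>p + q = z + v\<close>, \<open>r + t = z + u\<close>,
    \<open>u + q = x + r\<close>, \<open>v + t = x + p\<close> and
    \<open>v + r = y + q\<close>.\<close>
  have fixed: "q < x" "t < x" "u < v" "v < y" "p < v" "r < u" "q < r" "t < p"
    using sums less z by linarith+
  \<comment> \<open>Only neighbouring cells are compared; transitivity restores
    \<open>sorted_wrt\<close> afterwards. Splitting \<open>neq\<close> gives 128 cases:
    \<open>simp; fail\<close> accepts only a complete proof by \<open>simp\<close>, such as finding
    a listed order that fits, and \<open>linarith\<close> refutes what is left.\<close>
  have "\<exists>xs\<in>set normal_lists. successively (\<lambda>(i, j) (k, l). A $ i $ j < A $ k $ l) xs"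
    unfolding normal_lists_def normal_table_def normal_list_def Let_def
    by (simp flip: defs add: less z fixed, use neq in \<open>elim disjE\<close>)
      (simp; fail | use sums fixed in linarith)+
  then show ?thesis
    by (subst (asm) successively_conv_sorted_wrt) (auto simp: transp_def)
qed

lemma card_normal: "card {r \<in> order_types. normal r} = 18"
proof -
  have "{r \<in> order_types. normal r} = list_order ` set normal_lists"
  proof (intro equalityI subsetI)
    fix r assume "r \<in> {r \<in> order_types. normal r}"
    then obtain A where A: "semimagic A" "r = order_type A" "normal r"
      by (auto simp: order_types_def)
    with normal_semimagic_sorted obtain xs where
      "xs \<in> set normal_lists" "sorted_wrt (\<lambda>(i, j) (k, l). A $ i $ j < A $ k $ l) xs" by blast
    then show "r \<in> list_order ` set normal_lists"
      using A(2) order_type_eq_list_order normal_lists_UNIV by blast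
  qed (auto intro: normal_list_order normal_list_semimagic)
  moreover have "inj_on list_order (set normal_lists)"
    using normal_lists_distinct normal_lists_UNIV by (intro inj_onI list_order_inject) auto
  ultimately show ?thesis
    using distinct_normal_lists by (simp add: card_image distinct_card)
qed

theorem mainTheorem8:
  shows "card order_types = 1296 \<and>
         card (order_types // symmetric_order_types) = 18"
proof -
  have "card (order_types // symmetric_order_types) = 18"
    using bij_betw_same_card[OF bij_betw_normal_orbits] card_normal by simp
  then show ?thesis using card_order_types by simp
qed

end
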